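(* Suppose $0<\alpha<1$ and $\tau>0$. Let $\sigma_1>1$, $\sigma_2<1$, $\lambda>0$ and $\mu_1,\mu_2,\eta\ge0$. Let $y_i$, $0\le i\le N$, be a sequence of non-negative real numbers satisfying $$D_\tau^\alpha y_n\le\lambda y_n+\mu_1 n^{-\sigma_1}+\mu_2 n^{-\sigma_2}+\eta,\qquad n=1,\dots,N.$$ Then, with $\tau_*=\sqrt[\alpha]{\frac{1}{2\Gamma(2-\alpha)\lambda}}$, whenever $\tau<\tau_*$ it holds, for $n=1,\dots,N$, that $$y_n\lesssim y_0+\mu_1\tau^\alpha n^{\alpha-1}+\mu_2\tau^\alpha n^{\alpha-\sigma_2}+\eta\,\tau^\alpha n^\alpha.$$
   Context: The time step is $\tau=T/N$ for a fixed final time $T>0$ and a positive integer $N$. The L1 operator acting on a sequence is $$D_\tau^\alpha y_n=\frac{\tau^{-\alpha}}{\Gamma(2-\alpha)}\sum_{j=1}^n a_{n-j}(y_j-y_{j-1}),\qquad a_i=(i+1)^{1-\alpha}-i^{1-\alpha},\ i\ge0.$$ $A\lesssim B$ means $A\le cB$ for a constant $c$; here $c$ is independent of $n$, $N$, $\tau$, $\mu_1,\mu_2,\eta$ and of the sequence (it may depend on $\alpha,\lambda,\sigma_1,\sigma_2,T$). *)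

theory Defs
  imports "HOL-Analysis.Gamma_Function"
begin

text \<open>At \<open>i = 0\<close> the subtracted term is \<open>0 powr (1 - \<alpha>) = 0\<close>, as intended for \<open>\<alpha> < 1\<close>.\<close>

definition L1_weight :: "real \<Rightarrow> nat \<Rightarrow> real" where
  "L1_weight \<alpha> i = real (i + 1) powr (1 - \<alpha>) - real i powr (1 - \<alpha>)"

definition L1_op :: "real \<Rightarrow> real \<Rightarrow> (nat \<Rightarrow> real) \<Rightarrow> nat \<Rightarrow> real" where
  "L1_op \<alpha> \<tau> y n =
     \<tau> powr (-\<alpha>) / Gamma (2 - \<alpha>) * (\<Sum>j = 1..n. L1_weight \<alpha> (n - j) * (y j - y (j - 1)))"

text \<open>The \<open>\<alpha>\<close>-th root, with real \<open>\<alpha>\<close>, is the power with exponent \<open>1 / \<alpha>\<close>.\<close>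

definition tau_star :: "real \<Rightarrow> real \<Rightarrow> real" where
  "tau_star \<alpha> lam = (1 / (2 * Gamma (2 - \<alpha>) * lam)) powr (1 / \<alpha>)"

end

theory Submission
  imports Defs
begin

text \<open>
  The L1 operator is, up to a factor, the discrete convolution of the weights \<open>a\<^sub>i = (i+1)\<^bsup>1-\<alpha>\<^esup> - i\<^bsup>1-\<alpha>\<^esup>\<close> with the
  increments of the sequence. It is inverted by the complementary kernel \<open>P\<close>, the sequence with
  \<open>\<Sum>\<^sub>i P\<^sub>i a\<^bsub>n-i\<^esub> = 1\<close> for every \<open>n\<close>: if \<open>P \<ge> 0\<close>, convolving the hypothesis with \<open>P\<close> turns it into the discrete weakly
  singular integral inequality
  \<open>y\<^sub>n \<le> y\<^sub>0 + \<Gamma>(2-\<alpha>) \<tau>\<^sup>\<alpha> \<Sum>\<^sub>j P\<^bsub>n-j\<^esub> (\<lambda> y\<^sub>j + f\<^sub>j)\<close>. The condition \<open>\<tau> < \<tau>\<^sub>*\<close> says exactly that the diagonal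
  coefficient \<open>\<Gamma>(2-\<alpha>) \<tau>\<^sup>\<alpha> \<lambda>\<close> is below one half, so that the term \<open>j = n\<close> can be absorbed on the left
  at the cost of a factor two.

  The kernel must be bounded pointwise by a multiple of \<open>(n+1)\<^bsup>\<alpha>-1\<^esup>\<close>; a bound on its partial sums
  would not give the decaying term \<open>n\<^bsup>\<alpha>-1\<^esup>\<close>. The weights are log-convex, so by a theorem of Kaluza
  the reciprocal of their generating function has non-positive coefficients beyond the first
  (\<open>fps_inverse_log_convex_nonpos\<close>). The partial sums of these coefficients are the complementary
  kernel, which is therefore decreasing, and then \<open>(n+1) P\<^sub>n a\<^sub>n \<le> \<Sum>\<^sub>i P\<^sub>i a\<^bsub>n-i\<^esub> = 1\<close> yields the bound.

  The forcing contributes convolutions of \<open>n\<^bsup>\<alpha>-1\<^esup>\<close> with \<open>n\<^bsup>-s\<^esup>\<close>, which are of order \<open>n\<^bsup>\<alpha>-s\<^esup>\<close> for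
  \<open>s < 1\<close> and of order \<open>n\<^bsup>\<alpha>-1\<^esup>\<close> for \<open>s > 1\<close>. Hence the right-hand side of the claim, call it \<open>\<rho>\<^sub>n\<close>, dominates
  \<open>y\<^sub>0\<close> and the forcing. It remains to control the feedback of \<open>y\<^sub>j\<close> with \<open>j < n\<close>. Each of the four
  summands of \<open>\<rho>\<close> is a multiple of a power \<open>n\<^bsup>-s\<^esup>\<close> with \<open>s < 1\<close>, and for such powers convolution
  with the damped kernel \<open>\<tau>\<^sup>\<alpha> k\<^bsup>\<alpha>-1\<^esup> e\<^bsup>-\<beta>\<tau>k\<^esup>\<close> multiplies the size by at most a constant times
  \<open>\<beta>\<^bsup>-\<alpha>\<^esup>\<close>, uniformly in \<open>\<tau>\<close> and \<open>n\<close> (\<open>powr_exp_convolution_bound\<close>). For \<open>\<beta>\<close> large, comparison with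
  \<open>\<rho>\<^sub>n e\<^bsup>\<beta>\<tau>n\<^esup>\<close> closes by induction (\<open>weakly_singular_gronwall\<close>), and \<open>\<tau>n \<le> T\<close> makes the exponential a
  constant.
\<close>

section \<open>Reciprocals of log-convex power series\<close>

lemma fps_inverse_convolution:
  fixes a :: "nat \<Rightarrow> real"
  assumes "a 0 \<noteq> 0"
  shows "(\<Sum>i=0..n. fps_nth (inverse (Abs_fps a)) i * a (n - i)) = (if n = 0 then 1 else 0)"
proof -
  have "inverse (Abs_fps a) * Abs_fps a = 1"
    using assms by (intro inverse_mult_eq_1) simp
  from arg_cong[OF this, of "\<lambda>f. fps_nth f n"] show ?thesis
    by (simp add: fps_mult_nth)
qed

text \<open>Kaluza's theorem. Let \<open>d\<close> be the reciprocal series and \<open>r\<^sub>k = a\<^bsub>k+1\<^esub> / a\<^sub>k\<close>. Subtracting \<open>r\<^sub>n\<close>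
  times the \<open>n\<close>-th from the \<open>(n+1)\<close>-st equation of \<open>d * a = 1\<close> cancels the positive \<open>d\<^sub>0\<close> and leaves
  \<open>d\<^bsub>n+1\<^esub> a\<^sub>0 = - \<Sum>\<^sub>i d\<^sub>i a\<^bsub>n-i\<^esub> (r\<^bsub>n-i\<^esub> - r\<^sub>n)\<close>, a sum of products of two non-positive factors, because \<open>r\<close>
  increases.\<close>

lemma fps_inverse_log_convex_nonpos:
  fixes a :: "nat \<Rightarrow> real"
  assumes pos: "\<And>k. 0 < a k"
    and log_convex: "\<And>k. a (Suc k) / a k \<le> a (Suc (Suc k)) / a (Suc k)"
  shows "fps_nth (inverse (Abs_fps a)) (Suc n) \<le> 0"
proof (induction n rule: less_induct)
  case (less n)
  define d where "d = fps_nth (inverse (Abs_fps a))"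
  define r where "r = (\<lambda>k. a (Suc k) / a k)"
  have conv: "(\<Sum>i=0..m. d i * a (m - i)) = (if m = 0 then 1 else 0)" for m
    using fps_inverse_convolution[of a m] pos[of 0] by (simp add: d_def)
  have r_mono: "r i \<le> r j" if "i \<le> j" for i j
    using lift_Suc_mono_le[of r, OF _ that] log_convex by (simp add: r_def)
  have last: "d (Suc n) * a 0 = - (\<Sum>i=0..n. d i * a (Suc n - i))"
    using conv[of "Suc n"] by simp
  have "0 \<le> (\<Sum>i=0..n. d i * a (Suc n - i))"
  proof (cases "n = 0")
    case True
    have "d 0 * a 0 = 1" using conv[of 0] by simp
    then have "0 < d 0" using pos[of 0] by (metis zero_less_mult_pos2 zero_less_one)
    with True pos[of 1] show ?thesis by simp
  next
    case False
    \<comment> \<open>The subtracted convolution is the coefficient at \<open>n\<close>, which vanishes only for \<open>n > 0\<close>.\<close>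
    have "(\<Sum>i=0..n. d i * a (Suc n - i))
        = (\<Sum>i=0..n. d i * a (Suc n - i)) - r n * (\<Sum>i=0..n. d i * a (n - i))"
      using conv[of n] False by simp
    also have "\<dots> = (\<Sum>i=0..n. d i * (a (n - i) * (r (n - i) - r n)))"
      unfolding sum_distrib_left sum_subtractf[symmetric]
    proof (intro sum.cong refl)
      fix i assume "i \<in> {0..n}"
      then have "a (Suc n - i) = a (n - i) * r (n - i)"
        using pos[of "n - i"] by (simp add: r_def Suc_diff_le)
      then show "d i * a (Suc n - i) - r n * (d i * a (n - i))
          = d i * (a (n - i) * (r (n - i) - r n))"
        by (simp add: algebra_simps)
    qed
    also have "\<dots> \<ge> 0"
    proof (intro sum_nonneg)
      fix i assume i: "i \<in> {0..n}"
      show "0 \<le> d i * (a (n - i) * (r (n - i) - r n))"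
      proof (cases i)
        case (Suc k)
        then have "d i \<le> 0" using less.IH[of k] i by (simp add: d_def)
        moreover have "a (n - i) * (r (n - i) - r n) \<le> 0"
          using pos[of "n - i"] r_mono[of "n - i" n] by (simp add: mult_le_0_iff)
        ultimately show ?thesis by (rule mult_nonpos_nonpos)
      qed simp
    qed
    finally show ?thesis .
  qed
  with last have "d (Suc n) * a 0 \<le> 0" by simp
  with pos[of 0] show ?case by (simp add: d_def mult_le_0_iff)
qed

text \<open>Summing the reciprocal series amounts to multiplying it by \<open>1 / (1 - X)\<close>, so the kernel is the
  solution \<open>P\<close> of \<open>P * a = 1 / (1 - X)\<close>, i.e. \<open>\<Sum>\<^sub>i P\<^sub>i a\<^bsub>n-i\<^esub> = 1\<close> for every \<open>n\<close>.\<close>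

definition complementary_kernel :: "(nat \<Rightarrow> real) \<Rightarrow> nat \<Rightarrow> real" where
  "complementary_kernel a n = (\<Sum>i=0..n. fps_nth (inverse (Abs_fps a)) i)"

lemma Abs_fps_complementary_kernel:
  "Abs_fps (complementary_kernel a) = inverse (Abs_fps a) * Abs_fps (\<lambda>_. 1)"
  by (rule fps_ext) (simp add: complementary_kernel_def fps_mult_nth)

lemma complementary_kernel_mult:
  fixes a :: "nat \<Rightarrow> real"
  assumes "a 0 \<noteq> 0"
  shows "Abs_fps (complementary_kernel a) * Abs_fps a = Abs_fps (\<lambda>_. 1)"
proof -
  have "inverse (Abs_fps a) * Abs_fps a = 1"
    using assms by (intro inverse_mult_eq_1) simp
  moreover have "inverse (Abs_fps a) * Abs_fps (\<lambda>_. 1) * Abs_fps a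
      = inverse (Abs_fps a) * Abs_fps a * Abs_fps (\<lambda>_. 1)"
    by (simp only: mult_ac)
  ultimately show ?thesis
    by (simp only: Abs_fps_complementary_kernel mult_1_left)
qed

text \<open>The inner sums are \<open>a * u\<close> for the increments \<open>u\<close> of \<open>z\<close>, and \<open>P * (a * u) = (P * a) * u\<close> is
  the sequence of partial sums of \<open>u\<close>.\<close>

lemma complementary_kernel_telescope:
  fixes a z :: "nat \<Rightarrow> real"
  assumes "a 0 \<noteq> 0"
  shows "(\<Sum>j=1..n. complementary_kernel a (n - j) * (\<Sum>k=1..j. a (j - k) * (z k - z (k - 1))))
       = z n - z 0"
proof -
  \<comment> \<open>The value zero at \<open>k = 0\<close> lets the sums start at zero, as products of power series require.\<close>
  define u where "u = (\<lambda>k. if k = 0 then 0 else z k - z (k - 1))"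
  have drop0: "(\<Sum>k=0..j. f k * u (k::nat)) = (\<Sum>k=1..j. f k * (z k - z (k - 1)))" for f j
    by (rule sum.mono_neutral_cong_right) (auto simp: u_def)
  let ?P = "Abs_fps (complementary_kernel a)" and ?A = "Abs_fps a" and ?U = "Abs_fps u"
  have inner: "fps_nth (?U * ?A) j = (\<Sum>k=1..j. a (j - k) * (z k - z (k - 1)))" for j
    unfolding fps_mult_nth fps_nth_Abs_fps
    using drop0[of "\<lambda>k. a (j - k)" j] by (simp add: mult.commute)
  have "(\<Sum>j=1..n. complementary_kernel a (n - j) * (\<Sum>k=1..j. a (j - k) * (z k - z (k - 1))))
      = (\<Sum>j=0..n. complementary_kernel a (n - j) * fps_nth (?U * ?A) j)"
    by (rule sum.mono_neutral_cong_left) (auto simp: inner)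
  also have "\<dots> = fps_nth (?U * ?A * ?P) n"
    unfolding fps_mult_nth[of "?U * ?A" ?P] fps_nth_Abs_fps by (intro sum.cong refl mult.commute)
  also have "\<dots> = fps_nth (?U * Abs_fps (\<lambda>_. 1)) n"
    by (simp only: mult.assoc mult.commute[of ?A ?P] complementary_kernel_mult[of a, OF assms])
  also have "\<dots> = (\<Sum>k=0..n. u k)"
    by (simp add: fps_mult_nth)
  also have "\<dots> = z n - z 0"
    by (induction n) (auto simp: u_def)
  finally show ?thesis .
qed

lemma complementary_kernel_0: "complementary_kernel a 0 = inverse (a 0)"
  by (simp add: complementary_kernel_def)

lemma complementary_kernel_decreasing:
  fixes a :: "nat \<Rightarrow> real"
  assumes "\<And>k. 0 < a k"
    and "\<And>k. a (Suc k) / a k \<le> a (Suc (Suc k)) / a (Suc k)"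
    and "i \<le> j"
  shows "complementary_kernel a j \<le> complementary_kernel a i"
proof (rule lift_Suc_antimono_le[OF _ assms(3)])
  fix k
  show "complementary_kernel a (Suc k) \<le> complementary_kernel a k"
    using fps_inverse_log_convex_nonpos[of a k, OF assms(1,2)]
    by (simp add: complementary_kernel_def)
qed

text \<open>In \<open>\<Sum>\<^sub>i d\<^sub>i a\<^bsub>n-i\<^esub> \<ge> 0\<close> only \<open>d\<^sub>0\<close>, whose factor is already \<open>a\<^sub>n\<close>, is positive; replacing the other
  factors \<open>a\<^bsub>n-i\<^esub>\<close> by the smaller \<open>a\<^sub>n\<close> can only increase the sum, which becomes \<open>P\<^sub>n a\<^sub>n\<close>.\<close>

lemma complementary_kernel_nonneg:
  fixes a :: "nat \<Rightarrow> real"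
  assumes pos: "\<And>k. 0 < a k"
    and log_convex: "\<And>k. a (Suc k) / a k \<le> a (Suc (Suc k)) / a (Suc k)"
    and decreasing: "\<And>i j. i \<le> j \<Longrightarrow> a j \<le> a i"
  shows "0 \<le> complementary_kernel a n"
proof -
  define d where "d = fps_nth (inverse (Abs_fps a))"
  have "0 \<le> (\<Sum>i=0..n. d i * a (n - i))"
    using fps_inverse_convolution[of a n] pos[of 0] by (simp add: d_def)
  also have "\<dots> \<le> (\<Sum>i=0..n. d i * a n)"
  proof (intro sum_mono)
    fix i assume "i \<in> {0..n}"
    show "d i * a (n - i) \<le> d i * a n"
    proof (cases i)
      case (Suc k)
      then have "d i \<le> 0"
        using fps_inverse_log_convex_nonpos[of a k] pos log_convex by (simp add: d_def)
      then show ?thesis using decreasing[of "n - i" n] by (intro mult_left_mono_neg) auto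
    qed simp
  qed
  also have "\<dots> = complementary_kernel a n * a n"
    by (simp add: complementary_kernel_def d_def sum_distrib_right)
  finally show ?thesis using pos[of n] by (simp add: zero_le_mult_iff)
qed

text \<open>Both sequences decrease, so each of the \<open>n + 1\<close> terms of \<open>\<Sum>\<^sub>i P\<^sub>i a\<^bsub>n-i\<^esub> = 1\<close> is at least
  \<open>P\<^sub>n a\<^sub>n\<close>.\<close>

lemma complementary_kernel_le:
  fixes a :: "nat \<Rightarrow> real"
  assumes pos: "\<And>k. 0 < a k"
    and log_convex: "\<And>k. a (Suc k) / a k \<le> a (Suc (Suc k)) / a (Suc k)"
    and decreasing: "\<And>i j. i \<le> j \<Longrightarrow> a j \<le> a i"
  shows "complementary_kernel a n \<le> 1 / (real (Suc n) * a n)"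
proof -
  let ?P = "complementary_kernel a"
  have "real (Suc n) * (?P n * a n) = (\<Sum>i=0..n. ?P n * a n)"
    by simp
  also have "\<dots> \<le> (\<Sum>i=0..n. ?P i * a (n - i))"
  proof (intro sum_mono mult_mono)
    fix i assume i: "i \<in> {0..n}"
    show "?P n \<le> ?P i" using complementary_kernel_decreasing[of a i n] pos log_convex i by simp
    show "a n \<le> a (n - i)" using decreasing by simp
    show "0 \<le> ?P i" using complementary_kernel_nonneg[of a] assms by simp
    show "0 \<le> a n" using pos[of n] by simp
  qed
  also have "\<dots> = 1"
    using arg_cong[OF complementary_kernel_mult[of a], of "\<lambda>f. fps_nth f n"] pos[of 0]
    by (simp add: fps_mult_nth)
  finally have "?P n * (real (Suc n) * a n) \<le> 1" by (simp only: mult_ac)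
  moreover have "0 < real (Suc n) * a n" using pos[of n] by simp
  ultimately show ?thesis by (simp only: pos_le_divide_eq)
qed

section \<open>The L1 weights\<close>

lemma L1_weight_0: "L1_weight \<alpha> 0 = 1"
  by (simp add: L1_weight_def)

lemma L1_weight_pos:
  assumes "\<alpha> < 1"
  shows "0 < L1_weight \<alpha> i"
proof -
  have "real i powr (1 - \<alpha>) < real (i + 1) powr (1 - \<alpha>)"
    using assms by (intro powr_less_mono2) auto
  then show ?thesis by (simp only: L1_weight_def diff_gt_0_iff_gt)
qed

text \<open>Cauchy's mean value theorem for \<open>(x + 1)\<^bsup>1-\<alpha>\<^esup>\<close> and \<open>x\<^bsup>1-\<alpha>\<^esup>\<close> on \<open>[i, i+1]\<close>. For \<open>\<alpha> > 0\<close> the factor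
  on the right is below one and increases with \<open>\<xi>\<close>, and the points \<open>\<xi>\<close> of successive \<open>i\<close> increase: this gives
  monotonicity and log-convexity of the weights at once.\<close>

lemma L1_weight_ratio:
  assumes "\<alpha> < 1"
  obtains \<xi> where "real i < \<xi>" "\<xi> < real i + 1"
    "L1_weight \<alpha> (Suc i) = L1_weight \<alpha> i * (\<xi> / (\<xi> + 1)) powr \<alpha>"
proof -
  \<comment> \<open>Rolle's theorem for this combination needs only continuity at \<open>0\<close>, where \<open>x\<^bsup>1-\<alpha>\<^esup>\<close> need not be differentiable.\<close>
  define h where "h = (\<lambda>x. L1_weight \<alpha> i * (x + 1) powr (1 - \<alpha>) - L1_weight \<alpha> (Suc i) * x powr (1 - \<alpha>))"
  have h': "(h has_real_derivative
      (1 - \<alpha>) * (L1_weight \<alpha> i * (x + 1) powr - \<alpha> - L1_weight \<alpha> (Suc i) * x powr - \<alpha>)) (at x)"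
    if "0 < x" for x
    unfolding h_def using that by (auto intro!: derivative_eq_intros simp: algebra_simps)
  have "\<exists>z>real i. z < real i + 1 \<and> (h has_real_derivative 0) (at z)"
  proof (rule Rolle)
    show "h (real i) = h (real i + 1)"
      by (simp add: h_def L1_weight_def algebra_simps)
    show "continuous_on {real i..real i + 1} h"
      unfolding h_def using assms by (intro continuous_intros continuous_on_powr') auto
    show "h differentiable (at x)" if "real i < x" for x
      using h'[of x] that real_differentiable_def by auto
  qed simp
  then obtain z where z: "real i < z" "z < real i + 1" "(h has_real_derivative 0) (at z)"
    by auto
  have z0: "0 < z" using z(1) by linarith
  have "(1 - \<alpha>) * (L1_weight \<alpha> i * (z + 1) powr - \<alpha> - L1_weight \<alpha> (Suc i) * z powr - \<alpha>) = 0"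
    by (rule DERIV_unique[OF h'[OF z0] z(3)])
  then have eq: "L1_weight \<alpha> (Suc i) * z powr - \<alpha> = L1_weight \<alpha> i * (z + 1) powr - \<alpha>"
    using assms by simp
  have "L1_weight \<alpha> (Suc i) = L1_weight \<alpha> (Suc i) * z powr - \<alpha> * z powr \<alpha>"
    using z0 by (simp add: powr_minus)
  also have "\<dots> = L1_weight \<alpha> i * ((z + 1) powr - \<alpha> * z powr \<alpha>)"
    unfolding eq by (simp only: mult.assoc)
  also have "(z + 1) powr - \<alpha> * z powr \<alpha> = (z / (z + 1)) powr \<alpha>"
    using z0 by (simp add: powr_divide powr_minus_divide)
  finally have "L1_weight \<alpha> (Suc i) = L1_weight \<alpha> i * (z / (z + 1)) powr \<alpha>" .
  with z(1,2) that show thesis by blast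
qed

lemma L1_weight_log_convex:
  assumes "0 < \<alpha>" "\<alpha> < 1"
  shows "L1_weight \<alpha> (Suc i) / L1_weight \<alpha> i \<le> L1_weight \<alpha> (Suc (Suc i)) / L1_weight \<alpha> (Suc i)"
proof -
  obtain x where x: "real i < x" "x < real i + 1"
    "L1_weight \<alpha> (Suc i) = L1_weight \<alpha> i * (x / (x + 1)) powr \<alpha>"
    using L1_weight_ratio assms(2) by blast
  obtain y where y: "real (Suc i) < y" "y < real (Suc i) + 1"
    "L1_weight \<alpha> (Suc (Suc i)) = L1_weight \<alpha> (Suc i) * (y / (y + 1)) powr \<alpha>"
    using L1_weight_ratio assms(2) by blast
  have "0 < x" "x \<le> y" using x(1,2) y(1) by auto
  then have "x / (x + 1) \<le> y / (y + 1)" by (simp add: field_simps)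
  then have "(x / (x + 1)) powr \<alpha> \<le> (y / (y + 1)) powr \<alpha>"
    using \<open>0 < x\<close> assms(1) by (intro powr_mono2) auto
  moreover have "L1_weight \<alpha> (Suc i) / L1_weight \<alpha> i = (x / (x + 1)) powr \<alpha>"
    using x(3) L1_weight_pos[OF assms(2), of i] by simp
  moreover have "L1_weight \<alpha> (Suc (Suc i)) / L1_weight \<alpha> (Suc i) = (y / (y + 1)) powr \<alpha>"
    using y(3) L1_weight_pos[OF assms(2), of "Suc i"] by simp
  ultimately show ?thesis by simp
qed

lemma L1_weight_decreasing:
  assumes "0 < \<alpha>" "\<alpha> < 1" "i \<le> j"
  shows "L1_weight \<alpha> j \<le> L1_weight \<alpha> i"
proof (rule lift_Suc_antimono_le[OF _ assms(3)])
  fix k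
  obtain x where x: "real k < x" "L1_weight \<alpha> (Suc k) = L1_weight \<alpha> k * (x / (x + 1)) powr \<alpha>"
    using L1_weight_ratio assms(2) by blast
  have "(x / (x + 1)) powr \<alpha> \<le> 1"
    using x(1) assms(1) by (intro powr_le1) auto
  then show "L1_weight \<alpha> (Suc k) \<le> L1_weight \<alpha> k"
    using x(2) L1_weight_pos[OF assms(2), of k] by (simp add: mult_le_cancel_left2)
qed

text \<open>The mean value theorem, with the decreasing derivative estimated at the right end point. The
  inequality bounds the L1 weights from below (\<open>p = 1 - \<alpha>\<close>) and, by telescoping, sums of powers
  from above.\<close>

lemma powr_increment_ge:
  fixes p :: real
  assumes "0 < p" "p \<le> 1"
  shows "p * real (Suc n) powr (p - 1) \<le> real (Suc n) powr p - real n powr p"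
proof -
  let ?f = "\<lambda>x::real. x powr p"
  have f': "(?f has_real_derivative p * x powr (p - 1)) (at x)" if "0 < x" for x
    using that by (rule has_real_derivative_powr)
  have "\<exists>l z. real n < z \<and> z < real (Suc n) \<and> (?f has_real_derivative l) (at z)
      \<and> ?f (real (Suc n)) - ?f (real n) = (real (Suc n) - real n) * l"
  proof (rule MVT)
    show "continuous_on {real n..real (Suc n)} ?f"
      using assms by (intro continuous_intros continuous_on_powr') auto
    show "?f differentiable (at x)" if "real n < x" for x
      using f'[of x] that real_differentiable_def by auto
  qed simp
  then obtain l z where z: "real n < z" "z < real (Suc n)" "(?f has_real_derivative l) (at z)"
    "?f (real (Suc n)) - ?f (real n) = l" by auto
  have z0: "0 < z" using z(1) by linarith
  have "real (Suc n) powr (p - 1) \<le> z powr (p - 1)"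
    using z0 z(2) assms by (intro powr_mono2') auto
  then show ?thesis
    using DERIV_unique[OF f'[OF z0] z(3)] z(4) assms(1) by auto
qed

lemma L1_complementary_kernel_le:
  assumes "0 < \<alpha>" "\<alpha> < 1"
  shows "complementary_kernel (L1_weight \<alpha>) n \<le> real (Suc n) powr (\<alpha> - 1) / (1 - \<alpha>)"
proof -
  have "(1 - \<alpha>) * real (Suc n) powr - \<alpha> \<le> L1_weight \<alpha> n"
    using powr_increment_ge[of "1 - \<alpha>" n] assms by (simp add: L1_weight_def add.commute)
  then have "1 / (real (Suc n) * L1_weight \<alpha> n)
      \<le> 1 / (real (Suc n) * ((1 - \<alpha>) * real (Suc n) powr - \<alpha>))"
    using assms by (intro divide_left_mono mult_left_mono mult_pos_pos L1_weight_pos) auto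
  also have "\<dots> = real (Suc n) powr (\<alpha> - 1) / (1 - \<alpha>)"
    by (simp add: powr_minus powr_diff field_simps)
  finally show ?thesis
    using complementary_kernel_le[of "L1_weight \<alpha>" n] assms
      L1_weight_pos L1_weight_log_convex L1_weight_decreasing by fastforce
qed

section \<open>Convolutions of weakly singular kernels with powers\<close>

text \<open>The factor \<open>2 powr \<bar>s\<bar>\<close> covers both signs of \<open>s\<close>: a power of \<open>j\<close> may be exchanged for the
  same power of \<open>n\<close> as long as \<open>n / 2 \<le> j \<le> n\<close>.\<close>

lemma powr_le_of_comparable:
  fixes a b s :: real
  assumes "0 < a" "a \<le> b" "b \<le> 2 * a"
  shows "a powr - s \<le> 2 powr \<bar>s\<bar> * b powr - s"
proof (cases "s \<le> 0")
  case True
  have "a powr - s \<le> b powr - s" using assms True by (intro powr_mono2) auto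
  also have "\<dots> \<le> 2 powr \<bar>s\<bar> * b powr - s"
    using ge_one_powr_ge_zero[of 2 "\<bar>s\<bar>"] by (simp add: mult_le_cancel_right1)
  finally show ?thesis .
next
  case False
  have "a powr - s \<le> (b / 2) powr - s" using assms False by (intro powr_mono2') auto
  also have "\<dots> = 2 powr \<bar>s\<bar> * b powr - s"
    using assms False by (simp add: powr_divide powr_minus field_simps)
  finally show ?thesis .
qed

lemma sum_powr_le:
  fixes p :: real
  assumes "0 < p" "p \<le> 1"
  shows "(\<Sum>j=1..n. real j powr (p - 1)) \<le> real n powr p / p"
proof (induction n)
  case (Suc n)
  have "(\<Sum>j=1..Suc n. real j powr (p - 1)) \<le> real n powr p / p + real (Suc n) powr (p - 1)"
    using Suc.IH by simp
  also have "\<dots> \<le> real (Suc n) powr p / p"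
  proof -
    have "real (Suc n) powr (p - 1) \<le> (real (Suc n) powr p - real n powr p) / p"
      using powr_increment_ge[OF assms, of n] assms(1)
      by (simp only: pos_le_divide_eq mult.commute)
    then show ?thesis by (simp add: diff_divide_distrib)
  qed
  finally show ?case .
qed simp

lemma sum_powr_bound:
  fixes s :: real
  assumes "s < 1"
  obtains C where "0 < C" "\<And>n. (\<Sum>j=1..n. real j powr - s) \<le> C * real n powr (1 - s)"
proof (cases "0 \<le> s")
  case True
  show thesis
    using that[of "1 / (1 - s)"] sum_powr_le[of "1 - s"] True assms by simp
next
  case False
  have "(\<Sum>j=1..n. real j powr - s) \<le> 1 * real n powr (1 - s)" for n
  proof -
    have "(\<Sum>j=1..n. real j powr - s) \<le> (\<Sum>j=1..n. real n powr - s)"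
      using False by (intro sum_mono powr_mono2) auto
    also have "\<dots> = 1 * real n powr (1 - s)"
      by (cases "n = 0") (simp_all add: powr_diff powr_minus field_simps)
    finally show ?thesis .
  qed
  then show thesis using that[of 1] by simp
qed

text \<open>Split at \<open>j = n / 2\<close>: for larger \<open>j\<close> the power is comparable to \<open>n powr - s\<close>, for smaller \<open>j\<close>
  the kernel is at most its value at \<open>n div 2\<close>. Keeping \<open>\<phi>\<close> abstract serves the plain kernel
  \<open>(k+1)\<^bsup>\<alpha>-1\<^esup>\<close> and its exponentially damped version alike.\<close>

lemma decreasing_convolution_powr_le:
  fixes \<phi> :: "nat \<Rightarrow> real"
  assumes nonneg: "\<And>k. 0 \<le> \<phi> k" and decreasing: "\<And>i j. i \<le> j \<Longrightarrow> \<phi> j \<le> \<phi> i"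
  shows "(\<Sum>j=1..n. \<phi> (n - j) * real j powr - s)
    \<le> 2 powr \<bar>s\<bar> * real n powr - s * (\<Sum>k<n. \<phi> k) + \<phi> (n div 2) * (\<Sum>j=1..n. real j powr - s)"
proof -
  have "(\<Sum>j=1..n. \<phi> (n - j) * real j powr - s)
      \<le> (\<Sum>j=1..n. 2 powr \<bar>s\<bar> * real n powr - s * \<phi> (n - j) + \<phi> (n div 2) * real j powr - s)"
  proof (intro sum_mono)
    fix j assume j: "j \<in> {1..n}"
    show "\<phi> (n - j) * real j powr - s
        \<le> 2 powr \<bar>s\<bar> * real n powr - s * \<phi> (n - j) + \<phi> (n div 2) * real j powr - s"
    proof (cases "n \<le> 2 * j")
      case True
      then have "real j powr - s \<le> 2 powr \<bar>s\<bar> * real n powr - s"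
        using j by (intro powr_le_of_comparable) auto
      from mult_right_mono[OF this nonneg[of "n - j"]] show ?thesis
        using nonneg[of "n div 2"] by (simp add: mult.commute add_increasing2)
    next
      case False
      then have "\<phi> (n - j) \<le> \<phi> (n div 2)" by (intro decreasing) auto
      then have "\<phi> (n - j) * real j powr - s \<le> \<phi> (n div 2) * real j powr - s"
        by (intro mult_right_mono) auto
      then show ?thesis using nonneg[of "n - j"] by (simp add: add_increasing)
    qed
  qed
  also have "\<dots> = 2 powr \<bar>s\<bar> * real n powr - s * (\<Sum>j=1..n. \<phi> (n - j))
      + \<phi> (n div 2) * (\<Sum>j=1..n. real j powr - s)"
    by (simp add: sum.distrib sum_distrib_left)
  also have "(\<Sum>j=1..n. \<phi> (n - j)) = (\<Sum>k<n. \<phi> k)"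
    by (rule sum.reindex_bij_witness[of _ "\<lambda>k. n - k" "\<lambda>j. n - j"]) auto
  finally show ?thesis .
qed

text \<open>The power sum is left unevaluated because its size decides between the next two bounds:
  it grows like \<open>n\<^bsup>1-s\<^esup>\<close> for \<open>s < 1\<close> and stays bounded for \<open>s > 1\<close>.\<close>

lemma powr_convolution_le:
  fixes \<alpha> s :: real
  assumes "0 < \<alpha>" "\<alpha> < 1"
  shows "(\<Sum>j=1..n. real (Suc (n - j)) powr (\<alpha> - 1) * real j powr - s)
    \<le> 2 powr \<bar>s\<bar> / \<alpha> * real n powr (\<alpha> - s) + 2 * real n powr (\<alpha> - 1) * (\<Sum>j=1..n. real j powr - s)"
proof (cases "n = 0")
  case False
  define \<phi> where "\<phi> = (\<lambda>k. real (Suc k) powr (\<alpha> - 1))"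
  have "(\<Sum>k<n. \<phi> k) \<le> real n powr \<alpha> / \<alpha>"
    using sum_powr_le[of \<alpha> n] assms by (simp add: \<phi>_def sum.atLeast1_atMost_eq)
  moreover have "\<phi> (n div 2) \<le> 2 * real n powr (\<alpha> - 1)"
  proof -
    have "\<phi> (n div 2) \<le> (real n / 2) powr (\<alpha> - 1)"
      unfolding \<phi>_def using False assms by (intro powr_mono2') auto
    also have "\<dots> = 2 powr (1 - \<alpha>) * real n powr (\<alpha> - 1)"
      by (simp add: powr_divide powr_diff)
    also have "\<dots> \<le> 2 * real n powr (\<alpha> - 1)"
      using powr_mono[of "1 - \<alpha>" 1 2] assms by (intro mult_right_mono) auto
    finally show ?thesis .
  qed
  ultimately have "2 powr \<bar>s\<bar> * real n powr - s * (\<Sum>k<n. \<phi> k) + \<phi> (n div 2) * (\<Sum>j=1..n. real j powr - s)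
      \<le> 2 powr \<bar>s\<bar> * real n powr - s * (real n powr \<alpha> / \<alpha>)
        + 2 * real n powr (\<alpha> - 1) * (\<Sum>j=1..n. real j powr - s)"
    by (intro add_mono mult_left_mono mult_right_mono sum_nonneg) auto
  moreover have "(\<Sum>j=1..n. \<phi> (n - j) * real j powr - s)
      \<le> 2 powr \<bar>s\<bar> * real n powr - s * (\<Sum>k<n. \<phi> k) + \<phi> (n div 2) * (\<Sum>j=1..n. real j powr - s)"
    using assms by (intro decreasing_convolution_powr_le) (auto simp: \<phi>_def intro!: powr_mono2')
  moreover have "2 powr \<bar>s\<bar> * real n powr - s * (real n powr \<alpha> / \<alpha>) = 2 powr \<bar>s\<bar> / \<alpha> * real n powr (\<alpha> - s)"
    by (simp add: powr_diff powr_minus field_simps)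
  ultimately show ?thesis unfolding \<phi>_def by linarith
qed simp

lemma powr_convolution_bound_slow:
  fixes \<alpha> s :: real
  assumes "0 < \<alpha>" "\<alpha> < 1" "s < 1"
  obtains C where "0 < C"
    "\<And>n. (\<Sum>j=1..n. real (Suc (n - j)) powr (\<alpha> - 1) * real j powr - s) \<le> C * real n powr (\<alpha> - s)"
proof -
  obtain C where C: "0 < C" "\<And>n. (\<Sum>j=1..n. real j powr - s) \<le> C * real n powr (1 - s)"
    using sum_powr_bound[OF assms(3)] by metis
  have "(\<Sum>j=1..n. real (Suc (n - j)) powr (\<alpha> - 1) * real j powr - s)
      \<le> (2 powr \<bar>s\<bar> / \<alpha> + 2 * C) * real n powr (\<alpha> - s)" for n
  proof -
    have "2 * real n powr (\<alpha> - 1) * (\<Sum>j=1..n. real j powr - s)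
        \<le> 2 * real n powr (\<alpha> - 1) * (C * real n powr (1 - s))"
      using C(2)[of n] by (intro mult_left_mono) auto
    also have "\<dots> = 2 * C * real n powr (\<alpha> - s)"
      by (cases "n = 0") (simp_all add: powr_diff field_simps)
    finally show ?thesis
      using powr_convolution_le[OF assms(1,2), of n s] by (simp add: distrib_right)
  qed
  moreover have "0 < 2 powr \<bar>s\<bar> / \<alpha> + 2 * C" using C(1) assms by (simp add: add_pos_pos)
  ultimately show thesis using that by blast
qed

lemma powr_convolution_bound_fast:
  fixes \<alpha> s :: real
  assumes "0 < \<alpha>" "\<alpha> < 1" "1 < s"
  obtains C where "0 < C"
    "\<And>n. (\<Sum>j=1..n. real (Suc (n - j)) powr (\<alpha> - 1) * real j powr - s) \<le> C * real n powr (\<alpha> - 1)"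
proof -
  define Z where "Z = (\<Sum>j. real j powr - s)"
  have summable: "summable (\<lambda>j. real j powr - s)"
    using assms by (simp add: summable_real_powr_iff)
  have Z: "(\<Sum>j=1..n. real j powr - s) \<le> Z" for n
    unfolding Z_def by (intro sum_le_suminf summable) auto
  have "(\<Sum>j=1..n. real (Suc (n - j)) powr (\<alpha> - 1) * real j powr - s)
      \<le> (2 powr \<bar>s\<bar> / \<alpha> + 2 * Z) * real n powr (\<alpha> - 1)" for n
  proof -
    have "real n powr (\<alpha> - s) \<le> real n powr (\<alpha> - 1)"
      using assms by (cases "n = 0") (auto intro: powr_mono)
    then have "2 powr \<bar>s\<bar> / \<alpha> * real n powr (\<alpha> - s) \<le> 2 powr \<bar>s\<bar> / \<alpha> * real n powr (\<alpha> - 1)"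
      using assms by (intro mult_left_mono) auto
    moreover have "2 * real n powr (\<alpha> - 1) * (\<Sum>j=1..n. real j powr - s)
        \<le> 2 * real n powr (\<alpha> - 1) * Z"
      using Z[of n] by (intro mult_left_mono) auto
    ultimately show ?thesis
      using powr_convolution_le[OF assms(1,2), of n s] by (simp add: algebra_simps)
  qed
  moreover have "0 < 2 powr \<bar>s\<bar> / \<alpha> + 2 * Z" using Z[of 0] assms by (simp add: add_pos_nonneg)
  ultimately show thesis using that by blast
qed

text \<open>A Riemann sum with mesh \<open>x\<close> for \<open>\<integral> u\<^bsup>\<alpha>-1\<^esup> e\<^bsup>-u\<^esup> du = \<Gamma>(\<alpha>)\<close>, with a bound uniform in \<open>x\<close>. Up to
  \<open>k = 1 / x\<close> the exponential is dropped and the power sum contributes \<open>1 / \<alpha>\<close>; beyond, the power is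
  estimated by its value at \<open>1 / x\<close> and the remaining geometric sum contributes at most \<open>1\<close>.\<close>

lemma sum_powr_exp_le:
  fixes \<alpha> x :: real
  assumes "0 < \<alpha>" "\<alpha> < 1" "0 < x"
  shows "(\<Sum>k=1..n. x powr \<alpha> * real k powr (\<alpha> - 1) * exp (- (x * real k))) \<le> 1 / \<alpha> + 1"
proof -
  define m where "m = nat \<lfloor>1 / x\<rfloor>"
  have m: "real m \<le> 1 / x" "1 / x < real m + 1"
    using assms(3) unfolding m_def by (simp_all add: floor_le_iff)
  let ?e = "\<lambda>k::nat. exp (- (x * real k))"
  have "(\<Sum>k=1..n. x powr \<alpha> * real k powr (\<alpha> - 1) * ?e k)
      \<le> (\<Sum>k=1..n. (if k \<le> m then x powr \<alpha> * real k powr (\<alpha> - 1) else 0) + (?e (k - 1) - ?e k))"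
  proof (intro sum_mono)
    fix k assume k: "k \<in> {1..n}"
    have step: "?e (k - 1) = exp x * ?e k"
      using k by (simp add: exp_add[symmetric] of_nat_diff algebra_simps)
    \<comment> \<open>The geometric part is summed by telescoping, using \<open>x \<le> exp x - 1\<close>.\<close>
    have diff: "x * ?e k \<le> ?e (k - 1) - ?e k"
      using mult_right_mono[OF exp_ge_add_one_self[of x], of "?e k"] step by (simp add: algebra_simps)
    show "x powr \<alpha> * real k powr (\<alpha> - 1) * ?e k
        \<le> (if k \<le> m then x powr \<alpha> * real k powr (\<alpha> - 1) else 0) + (?e (k - 1) - ?e k)"
    proof (cases "k \<le> m")
      case True
      have "x powr \<alpha> * real k powr (\<alpha> - 1) * ?e k \<le> x powr \<alpha> * real k powr (\<alpha> - 1) * 1"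
        using assms by (intro mult_left_mono) auto
      moreover have "0 \<le> x * ?e k" using assms by simp
      ultimately show ?thesis using True diff by simp
    next
      case False
      then have "1 / x \<le> real k" using m(2) by linarith
      then have "real k powr (\<alpha> - 1) \<le> (1 / x) powr (\<alpha> - 1)"
        using assms by (intro powr_mono2') auto
      then have "x powr \<alpha> * real k powr (\<alpha> - 1) \<le> x powr \<alpha> * (1 / x) powr (\<alpha> - 1)"
        by (intro mult_left_mono) auto
      also have "\<dots> = x"
        using assms by (simp add: powr_divide powr_diff)
      finally have "x powr \<alpha> * real k powr (\<alpha> - 1) * ?e k \<le> x * ?e k"
        by (intro mult_right_mono) auto
      with diff have "x powr \<alpha> * real k powr (\<alpha> - 1) * ?e k \<le> ?e (k - 1) - ?e k"
        by (rule order_trans[rotated])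
      with False show ?thesis by (simp only: if_False add_0)
    qed
  qed
  also have "\<dots> = (\<Sum>k=1..n. if k \<le> m then x powr \<alpha> * real k powr (\<alpha> - 1) else 0)
      + (\<Sum>k=1..n. ?e (k - 1) - ?e k)"
    by (rule sum.distrib)
  also have "(\<Sum>k=1..n. ?e (k - 1) - ?e k) = 1 - ?e n"
    by (induction n) auto
  also have "(\<Sum>k=1..n. if k \<le> m then x powr \<alpha> * real k powr (\<alpha> - 1) else 0)
      \<le> x powr \<alpha> * (\<Sum>k=1..m. real k powr (\<alpha> - 1))"
    unfolding sum_distrib_left sum.inter_filter[OF finite_atLeastAtMost, symmetric]
    using assms by (intro sum_mono2) auto
  also have "\<dots> \<le> x powr \<alpha> * ((1 / x) powr \<alpha> / \<alpha>)"
  proof (intro mult_left_mono)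
    have "real m powr \<alpha> / \<alpha> \<le> (1 / x) powr \<alpha> / \<alpha>"
      using m(1) assms by (intro divide_right_mono powr_mono2) auto
    then show "(\<Sum>k=1..m. real k powr (\<alpha> - 1)) \<le> (1 / x) powr \<alpha> / \<alpha>"
      using sum_powr_le[of \<alpha> m] assms by simp
  qed simp
  also have "\<dots> = 1 / \<alpha>"
    using assms by (simp add: powr_divide)
  finally have "(\<Sum>k=1..n. x powr \<alpha> * real k powr (\<alpha> - 1) * ?e k) \<le> 1 / \<alpha> + (1 - ?e n)" by simp
  also have "\<dots> \<le> 1 / \<alpha> + 1" by simp
  finally show ?thesis .
qed

lemma powr_exp_le_one:
  fixes u \<alpha> :: real
  assumes "0 < u" "0 < \<alpha>" "\<alpha> < 1"
  shows "u powr \<alpha> * exp (- u) \<le> 1"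
proof -
  have "u powr \<alpha> \<le> 1 + u"
  proof (cases "u \<le> 1")
    case True
    then have "u powr \<alpha> \<le> 1" using assms by (intro powr_le1) auto
    then show ?thesis using assms by simp
  next
    case False
    then have "u powr \<alpha> \<le> u powr 1" using assms by (intro powr_mono) auto
    then show ?thesis using assms by simp
  qed
  also have "\<dots> \<le> exp u" by (rule exp_ge_add_one_self)
  finally show ?thesis by (simp add: exp_minus field_simps)
qed

text \<open>With \<open>x = \<beta>\<tau>\<close> this says that the damped kernel maps \<open>n\<^bsup>-s\<^esup>\<close> to at most \<open>C \<beta>\<^bsup>-\<alpha>\<^esup> n\<^bsup>-s\<^esup>\<close> once the
  factor \<open>x\<^sup>\<alpha>\<close> is split as \<open>\<beta>\<^sup>\<alpha> \<tau>\<^sup>\<alpha>\<close>. Since \<open>C\<close> is independent of \<open>x\<close>, a large \<open>\<beta>\<close> makes the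
  map a contraction for every time step. The term \<open>j = n\<close> has to be left out: with a kernel value
  of order one at lag zero it would contribute \<open>x\<^sup>\<alpha>\<close>, which is unbounded.\<close>

lemma powr_exp_convolution_bound:
  fixes \<alpha> s :: real
  assumes "0 < \<alpha>" "\<alpha> < 1" "s < 1"
  obtains C where "0 < C"
    "\<And>x n. 0 < x \<Longrightarrow> (\<Sum>j=1..<n. x powr \<alpha> * real (n - j) powr (\<alpha> - 1) * exp (- (x * real (n - j)))
         * real j powr - s) \<le> C * real n powr - s"
proof -
  obtain C where C: "0 < C" "\<And>n. (\<Sum>j=1..n. real j powr - s) \<le> C * real n powr (1 - s)"
    using sum_powr_bound[OF assms(3)] by metis
  define D where "D = 2 powr \<bar>s\<bar> * (1 / \<alpha> + 1) + 2 * C"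
  have D0: "0 < D" unfolding D_def using C(1) assms by (simp add: add_pos_pos)
  \<comment> \<open>The kernel shifted by one is decreasing and finite at lag zero; passing from \<open>n - 1\<close> back to \<open>n\<close> costs another factor \<open>2 powr \<bar>s\<bar>\<close>.\<close>
  have bound: "(\<Sum>j=1..n. x powr \<alpha> * real (Suc (n - j)) powr (\<alpha> - 1) * exp (- (x * real (Suc (n - j))))
         * real j powr - s) \<le> D * real n powr - s" if x: "0 < x" and n: "0 < n" for x n
  proof -
    define \<phi> where "\<phi> = (\<lambda>k. x powr \<alpha> * real (Suc k) powr (\<alpha> - 1) * exp (- (x * real (Suc k))))"
    have "(\<Sum>k<n. \<phi> k) \<le> 1 / \<alpha> + 1"
      using sum_powr_exp_le[OF assms(1,2) x, of n] by (simp add: \<phi>_def sum.atLeast1_atMost_eq)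
    then have "2 powr \<bar>s\<bar> * real n powr - s * (\<Sum>k<n. \<phi> k) \<le> 2 powr \<bar>s\<bar> * real n powr - s * (1 / \<alpha> + 1)"
      by (intro mult_left_mono) auto
    moreover have "\<phi> (n div 2) * (\<Sum>j=1..n. real j powr - s) \<le> 2 / real n * (C * real n powr (1 - s))"
    proof (intro mult_mono C(2) sum_nonneg)
      let ?h = "real (Suc (n div 2))"
      \<comment> \<open>Far from the diagonal \<open>\<phi>\<close> is at most \<open>2 / n\<close>, because \<open>u\<^sup>\<alpha> e\<^bsup>-u\<^esup> \<le> 1\<close>.\<close>
      have "\<phi> (n div 2) = (x * ?h) powr \<alpha> * exp (- (x * ?h)) / ?h"
        using x by (simp add: \<phi>_def powr_mult powr_diff)
      also have "\<dots> \<le> 1 / ?h"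
        using x assms powr_exp_le_one[of "x * ?h" \<alpha>] by (intro divide_right_mono) auto
      also have "\<dots> \<le> 1 / (real n / 2)"
        using n by (intro divide_left_mono) auto
      finally show "\<phi> (n div 2) \<le> 2 / real n" by simp
    qed auto
    moreover have "2 / real n * (C * real n powr (1 - s)) = 2 * C * real n powr - s"
      using n by (simp add: powr_diff powr_minus field_simps)
    moreover have "(\<Sum>j=1..n. \<phi> (n - j) * real j powr - s)
        \<le> 2 powr \<bar>s\<bar> * real n powr - s * (\<Sum>k<n. \<phi> k) + \<phi> (n div 2) * (\<Sum>j=1..n. real j powr - s)"
    proof (rule decreasing_convolution_powr_le)
      show "0 \<le> \<phi> k" for k by (simp add: \<phi>_def)
      show "\<phi> j \<le> \<phi> i" if "i \<le> j" for i j
        unfolding \<phi>_def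
      proof (intro mult_mono)
        show "real (Suc j) powr (\<alpha> - 1) \<le> real (Suc i) powr (\<alpha> - 1)"
          using that assms by (intro powr_mono2') auto
      qed (use that x in auto)
    qed
    ultimately show ?thesis by (simp add: \<phi>_def D_def algebra_simps)
  qed
  have "(\<Sum>j=1..<n. x powr \<alpha> * real (n - j) powr (\<alpha> - 1) * exp (- (x * real (n - j)))
         * real j powr - s) \<le> (D * 2 powr \<bar>s\<bar>) * real n powr - s" if x: "0 < x" for x n
  proof (cases "n \<le> 1")
    case True
    then show ?thesis using D0 by (cases "n = 0") auto
  next
    case False
    then obtain m where m: "n = Suc m" "0 < m" by (cases n) auto
    have "(\<Sum>j=1..<n. x powr \<alpha> * real (n - j) powr (\<alpha> - 1) * exp (- (x * real (n - j)))
         * real j powr - s)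
       = (\<Sum>j=1..m. x powr \<alpha> * real (Suc (m - j)) powr (\<alpha> - 1) * exp (- (x * real (Suc (m - j))))
         * real j powr - s)"
      unfolding m(1) by (rule sum.cong) (auto simp: Suc_diff_le)
    also have "\<dots> \<le> D * real m powr - s" by (rule bound[OF x m(2)])
    also have "\<dots> \<le> D * (2 powr \<bar>s\<bar> * real n powr - s)"
      using m D0 by (intro mult_left_mono powr_le_of_comparable) auto
    finally show ?thesis by simp
  qed
  with D0 that[of "D * 2 powr \<bar>s\<bar>"] show thesis by simp
qed

section \<open>The discrete fractional Gronwall inequality\<close>

text \<open>Strong induction with the comparison sequence \<open>2 A \<rho>\<^sub>n e\<^bsup>\<beta>\<tau>n\<^esup>\<close>: writing
  \<open>e\<^bsup>\<beta>\<tau>j\<^esup> = e\<^bsup>\<beta>\<tau>n\<^esup> e\<^bsup>-\<beta>\<tau>(n-j)\<^esup>\<close> puts the damping on the kernel, so that the feedback is at most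
  \<open>2 A B C \<beta>\<^bsup>-\<alpha>\<^esup> \<rho>\<^sub>n e\<^bsup>\<beta>\<tau>n\<^esup>\<close>. The largeness of \<open>\<beta>\<close> makes this at most half of the comparison
  sequence; the other half absorbs \<open>A \<rho>\<^sub>n\<close>.\<close>

lemma weakly_singular_gronwall:
  fixes y \<rho> :: "nat \<Rightarrow> real" and \<alpha> \<beta> \<tau> A B C :: real
  assumes "0 < \<beta>" "0 < \<tau>" "0 \<le> A" "0 \<le> B"
    and rate_nonneg: "\<And>n. 0 \<le> \<rho> n"
    and rate: "\<And>n. (\<Sum>j=1..<n. (\<beta> * \<tau>) powr \<alpha> * real (n - j) powr (\<alpha> - 1)
        * exp (- (\<beta> * \<tau> * real (n - j))) * \<rho> j) \<le> C * \<rho> n"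
    and large: "2 * B * C \<le> \<beta> powr \<alpha>"
    and rec: "\<And>n. 1 \<le> n \<Longrightarrow> n \<le> N \<Longrightarrow>
        y n \<le> A * \<rho> n + B * \<tau> powr \<alpha> * (\<Sum>j=1..<n. real (n - j) powr (\<alpha> - 1) * y j)"
    and n: "1 \<le> n" "n \<le> N"
  shows "y n \<le> 2 * A * \<rho> n * exp (\<beta> * \<tau> * real n)"
  using n
proof (induction n rule: less_induct)
  case (less n)
  let ?E = "exp (\<beta> * \<tau> * real n)"
  \<comment> \<open>The factor \<open>\<beta> powr \<alpha>\<close> is carried along and cancelled at the end.\<close>
  have "\<beta> powr \<alpha> * (\<tau> powr \<alpha> * (\<Sum>j=1..<n. real (n - j) powr (\<alpha> - 1) * y j))
      \<le> \<beta> powr \<alpha> * (\<tau> powr \<alpha> * (\<Sum>j=1..<n. real (n - j) powr (\<alpha> - 1) * (2 * A * \<rho> j * exp (\<beta> * \<tau> * real j))))"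
    using less.prems by (intro mult_left_mono sum_mono less.IH) auto
  also have "\<dots> = 2 * A * ?E * (\<Sum>j=1..<n. (\<beta> * \<tau>) powr \<alpha> * real (n - j) powr (\<alpha> - 1)
        * exp (- (\<beta> * \<tau> * real (n - j))) * \<rho> j)"
    unfolding sum_distrib_left
  proof (intro sum.cong refl)
    fix j assume j: "j \<in> {1..<n}"
    have "exp (\<beta> * \<tau> * real j) = ?E * exp (- (\<beta> * \<tau> * real (n - j)))"
      using j by (simp add: exp_add[symmetric] of_nat_diff right_diff_distrib)
    moreover have "(\<beta> * \<tau>) powr \<alpha> = \<beta> powr \<alpha> * \<tau> powr \<alpha>"
      using assms(1,2) by (simp add: powr_mult)
    ultimately show "\<beta> powr \<alpha> * (\<tau> powr \<alpha> * (real (n - j) powr (\<alpha> - 1) * (2 * A * \<rho> j * exp (\<beta> * \<tau> * real j))))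
      = 2 * A * ?E * ((\<beta> * \<tau>) powr \<alpha> * real (n - j) powr (\<alpha> - 1)
        * exp (- (\<beta> * \<tau> * real (n - j))) * \<rho> j)"
      by (simp only: mult_ac)
  qed
  also have "\<dots> \<le> 2 * A * ?E * (C * \<rho> n)"
    using assms(3) by (intro mult_left_mono rate) auto
  finally have "B * (\<beta> powr \<alpha> * (\<tau> powr \<alpha> * (\<Sum>j=1..<n. real (n - j) powr (\<alpha> - 1) * y j)))
      \<le> B * (2 * A * ?E * (C * \<rho> n))"
    using assms(4) by (rule mult_left_mono)
  also have "\<dots> = (2 * B * C) * (A * ?E * \<rho> n)"
    by (simp only: mult_ac)
  also have "\<dots> \<le> \<beta> powr \<alpha> * (A * ?E * \<rho> n)"
    using large assms(3) rate_nonneg by (intro mult_right_mono) auto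
  finally have "\<beta> powr \<alpha> * (B * \<tau> powr \<alpha> * (\<Sum>j=1..<n. real (n - j) powr (\<alpha> - 1) * y j))
      \<le> \<beta> powr \<alpha> * (A * ?E * \<rho> n)"
    by (simp only: mult_ac)
  then have "B * \<tau> powr \<alpha> * (\<Sum>j=1..<n. real (n - j) powr (\<alpha> - 1) * y j) \<le> A * ?E * \<rho> n"
    using assms(1) by (simp add: mult_le_cancel_left_pos)
  moreover have "A * \<rho> n \<le> A * ?E * \<rho> n"
  proof -
    have "1 \<le> ?E" using assms(1,2) by simp
    then show ?thesis
      using mult_left_mono[of 1 ?E "A * \<rho> n"] assms(3) rate_nonneg[of n] by (simp add: mult_ac)
  qed
  ultimately show ?case
    using rec[OF less.prems] by (simp add: mult_ac)
qed

lemma L1_op_integrated: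
  assumes "\<alpha> < 1" "0 < \<tau>"
  shows "Gamma (2 - \<alpha>) * \<tau> powr \<alpha> * (\<Sum>j=1..n. complementary_kernel (L1_weight \<alpha>) (n - j) * L1_op \<alpha> \<tau> y j)
       = y n - y 0"
proof -
  have G: "Gamma (2 - \<alpha>) > 0" using assms by (intro Gamma_real_pos) auto
  have cancel: "Gamma (2 - \<alpha>) * \<tau> powr \<alpha> * (\<tau> powr - \<alpha> / Gamma (2 - \<alpha>)) = 1"
    using less_imp_neq[OF G] assms by (simp add: powr_minus)
  have "Gamma (2 - \<alpha>) * \<tau> powr \<alpha> * (complementary_kernel (L1_weight \<alpha>) (n - j) * L1_op \<alpha> \<tau> y j)
      = complementary_kernel (L1_weight \<alpha>) (n - j) * (\<Sum>k=1..j. L1_weight \<alpha> (j - k) * (y k - y (k - 1)))"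
    (is "?L = ?P * ?S") for j
  proof -
    have "?L = (Gamma (2 - \<alpha>) * \<tau> powr \<alpha> * (\<tau> powr - \<alpha> / Gamma (2 - \<alpha>))) * (?P * ?S)"
      by (simp only: L1_op_def mult_ac)
    then show ?thesis by (simp only: cancel mult_1_left)
  qed
  then show ?thesis
    using complementary_kernel_telescope[of "L1_weight \<alpha>" n y]
    by (simp add: sum_distrib_left L1_weight_0)
qed

text \<open>Integration of the L1 inequality with the complementary kernel. The term \<open>j = n\<close> of the feedback
  is absorbed on the left, which produces the factors two; every remaining lag is at least one,
  so the feedback kernel may be written \<open>(n - j)\<^bsup>\<alpha>-1\<^esup>\<close>.\<close>

lemma L1_inequality_integrated:
  fixes y f :: "nat \<Rightarrow> real"
  assumes "0 < \<alpha>" "\<alpha> < 1" "0 < lam" "0 < \<tau>" "\<tau> < tau_star \<alpha> lam"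
    and y: "\<And>i. i \<le> n \<Longrightarrow> 0 \<le> y i" and f: "\<And>j. 0 \<le> f j"
    and ineq: "\<And>j. 1 \<le> j \<Longrightarrow> j \<le> n \<Longrightarrow> L1_op \<alpha> \<tau> y j \<le> lam * y j + f j"
    and n: "1 \<le> n"
  shows "y n \<le> 2 * y 0
      + 2 * Gamma (2 - \<alpha>) / (1 - \<alpha>) * \<tau> powr \<alpha> * (\<Sum>j=1..n. real (Suc (n - j)) powr (\<alpha> - 1) * f j)
      + 2 * Gamma (2 - \<alpha>) * lam / (1 - \<alpha>) * \<tau> powr \<alpha> * (\<Sum>j=1..<n. real (n - j) powr (\<alpha> - 1) * y j)"
proof -
  define G where "G = Gamma (2 - \<alpha>)"
  define P where "P = complementary_kernel (L1_weight \<alpha>)"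
  have G: "0 < G" unfolding G_def using assms by (intro Gamma_real_pos) auto
  have P0: "P 0 = 1" by (simp add: P_def complementary_kernel_0 L1_weight_0)
  have P_nonneg: "0 \<le> P k" for k
    unfolding P_def using assms(1,2)
    by (intro complementary_kernel_nonneg L1_weight_pos L1_weight_log_convex L1_weight_decreasing)
  have P_le: "P k \<le> real (Suc k) powr (\<alpha> - 1) / (1 - \<alpha>)" for k
    unfolding P_def using assms(1,2) by (rule L1_complementary_kernel_le)
  have half: "G * \<tau> powr \<alpha> * lam \<le> 1 / 2"
  proof -
    have "\<tau> powr \<alpha> < tau_star \<alpha> lam powr \<alpha>"
      using assms by (intro powr_less_mono2) auto
    also have "\<dots> = 1 / (2 * G * lam)"
      using G assms(1,3) by (simp add: tau_star_def powr_powr flip: G_def)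
    finally show ?thesis
      using G assms(3) by (simp add: field_simps)
  qed
  define SF where "SF = (\<Sum>j=1..n. P (n - j) * f j)"
  define SY where "SY = (\<Sum>j=1..<n. P (n - j) * y j)"
  have "y n - y 0 = G * \<tau> powr \<alpha> * (\<Sum>j=1..n. P (n - j) * L1_op \<alpha> \<tau> y j)"
    unfolding G_def P_def using L1_op_integrated[OF assms(2,4)] by simp
  also have "\<dots> \<le> G * \<tau> powr \<alpha> * (\<Sum>j=1..n. P (n - j) * (lam * y j + f j))"
    using G P_nonneg by (intro mult_left_mono sum_mono ineq) auto
  also have "(\<Sum>j=1..n. P (n - j) * (lam * y j + f j)) = lam * (\<Sum>j=1..n. P (n - j) * y j) + SF"
    by (simp add: SF_def sum_distrib_left sum.distrib distrib_left mult_ac)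
  also have "(\<Sum>j=1..n. P (n - j) * y j) = y n + SY"
    using n P0 by (simp add: SY_def sum.last_plus atLeastLessThanSuc_atLeastAtMost[symmetric])
  finally have "y n - y 0 \<le> (G * \<tau> powr \<alpha> * lam) * y n + G * \<tau> powr \<alpha> * lam * SY + G * \<tau> powr \<alpha> * SF"
    by (simp add: algebra_simps)
  moreover have "(G * \<tau> powr \<alpha> * lam) * y n \<le> 1 / 2 * y n"
    using half y[of n] by (intro mult_right_mono) auto
  ultimately have main: "y n \<le> 2 * y 0 + 2 * (G * \<tau> powr \<alpha> * SF) + 2 * (G * \<tau> powr \<alpha> * lam * SY)"
    by linarith
  have "SF \<le> (\<Sum>j=1..n. real (Suc (n - j)) powr (\<alpha> - 1) / (1 - \<alpha>) * f j)"
    unfolding SF_def by (intro sum_mono mult_right_mono f P_le)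
  also have "\<dots> = 1 / (1 - \<alpha>) * (\<Sum>j=1..n. real (Suc (n - j)) powr (\<alpha> - 1) * f j)"
    by (simp add: sum_distrib_left)
  finally have "G * \<tau> powr \<alpha> * SF
      \<le> G * \<tau> powr \<alpha> * (1 / (1 - \<alpha>) * (\<Sum>j=1..n. real (Suc (n - j)) powr (\<alpha> - 1) * f j))"
    using G by (intro mult_left_mono) auto
  moreover have "G * \<tau> powr \<alpha> * lam * SY
      \<le> G * \<tau> powr \<alpha> * lam * (1 / (1 - \<alpha>) * (\<Sum>j=1..<n. real (n - j) powr (\<alpha> - 1) * y j))"
  proof (intro mult_left_mono)
    have "SY \<le> (\<Sum>j=1..<n. real (n - j) powr (\<alpha> - 1) / (1 - \<alpha>) * y j)"
      unfolding SY_def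
    proof (intro sum_mono mult_right_mono)
      fix j assume j: "j \<in> {1..<n}"
      have "real (Suc (n - j)) powr (\<alpha> - 1) \<le> real (n - j) powr (\<alpha> - 1)"
        using j assms by (intro powr_mono2') auto
      then show "P (n - j) \<le> real (n - j) powr (\<alpha> - 1) / (1 - \<alpha>)"
        using P_le[of "n - j"] assms(2) by (meson divide_right_mono diff_ge_0_iff_ge less_imp_le order_trans)
      show "0 \<le> y j" using y j by simp
    qed
    then show "SY \<le> 1 / (1 - \<alpha>) * (\<Sum>j=1..<n. real (n - j) powr (\<alpha> - 1) * y j)"
      by (simp add: sum_distrib_left)
  qed (use G assms in auto)
  ultimately have "y n \<le> 2 * y 0
      + 2 * (G * \<tau> powr \<alpha> * (1 / (1 - \<alpha>) * (\<Sum>j=1..n. real (Suc (n - j)) powr (\<alpha> - 1) * f j)))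
      + 2 * (G * \<tau> powr \<alpha> * lam * (1 / (1 - \<alpha>) * (\<Sum>j=1..<n. real (n - j) powr (\<alpha> - 1) * y j)))"
    using main by linarith
  then show ?thesis unfolding G_def by (simp add: mult_ac)
qed

theorem lemma2p2:
  fixes \<alpha> lam \<sigma>1 \<sigma>2 T :: real
  assumes "0 < \<alpha>" and "\<alpha> < 1" and "0 < lam" and "1 < \<sigma>1" and "\<sigma>2 < 1" and "0 < T"
  shows "\<exists>c>0. \<forall>(N::nat) (\<tau>::real) (\<mu>1::real) (\<mu>2::real) (\<eta>::real) (y::nat \<Rightarrow> real).
    0 < N \<longrightarrow> \<tau> = T / real N \<longrightarrow> \<tau> < tau_star \<alpha> lam \<longrightarrow>
    0 \<le> \<mu>1 \<longrightarrow> 0 \<le> \<mu>2 \<longrightarrow> 0 \<le> \<eta> \<longrightarrow>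
    (\<forall>i\<le>N. 0 \<le> y i) \<longrightarrow>
    (\<forall>n\<in>{1..N}. L1_op \<alpha> \<tau> y n
        \<le> lam * y n + \<mu>1 * real n powr (-\<sigma>1) + \<mu>2 * real n powr (-\<sigma>2) + \<eta>) \<longrightarrow>
    (\<forall>n\<in>{1..N}. y n
        \<le> c * (y 0 + \<mu>1 * \<tau> powr \<alpha> * real n powr (\<alpha> - 1)
               + \<mu>2 * \<tau> powr \<alpha> * real n powr (\<alpha> - \<sigma>2)
               + \<eta> * \<tau> powr \<alpha> * real n powr \<alpha>))"
proof -
  define G where "G = Gamma (2 - \<alpha>)"
  have G: "0 < G" unfolding G_def using assms by (intro Gamma_real_pos) auto

  let ?F = "\<lambda>s n. \<Sum>j=1..n. real (Suc (n - j)) powr (\<alpha> - 1) * real j powr - s"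
  obtain K1 where K1: "0 < K1" "\<And>n. ?F \<sigma>1 n \<le> K1 * real n powr (\<alpha> - 1)"
    using powr_convolution_bound_fast[OF assms(1,2,4)] by metis
  obtain K2 where K2: "0 < K2" "\<And>n. ?F \<sigma>2 n \<le> K2 * real n powr (\<alpha> - \<sigma>2)"
    using powr_convolution_bound_slow[OF assms(1,2,5)] by metis
  obtain K3 where K3: "0 < K3" "\<And>n. ?F 0 n \<le> K3 * real n powr (\<alpha> - 0)"
    by (rule powr_convolution_bound_slow[OF assms(1,2) zero_less_one]) blast

  let ?W = "\<lambda>x s n. \<Sum>j=1..<n. x powr \<alpha> * real (n - j) powr (\<alpha> - 1)
      * exp (- (x * real (n - j))) * real j powr - s"
  have W: "\<exists>C>0. \<forall>x>0. \<forall>n. ?W x s n \<le> C * real n powr - s" if "s < 1" for s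
    by (rule powr_exp_convolution_bound[OF assms(1,2) that]) blast
  obtain C0 where C0: "0 < C0" "\<And>x n. 0 < x \<Longrightarrow> ?W x 0 n \<le> C0 * real n powr - 0"
    using W[of 0] by auto
  obtain C1 where C1: "0 < C1" "\<And>x n. 0 < x \<Longrightarrow> ?W x (1 - \<alpha>) n \<le> C1 * real n powr - (1 - \<alpha>)"
    using W[of "1 - \<alpha>"] assms by auto
  obtain C2 where C2: "0 < C2" "\<And>x n. 0 < x \<Longrightarrow> ?W x (\<sigma>2 - \<alpha>) n \<le> C2 * real n powr - (\<sigma>2 - \<alpha>)"
    using W[of "\<sigma>2 - \<alpha>"] assms by auto
  obtain C3 where C3: "0 < C3" "\<And>x n. 0 < x \<Longrightarrow> ?W x (- \<alpha>) n \<le> C3 * real n powr - (- \<alpha>)"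
    using W[of "- \<alpha>"] assms by auto

  define K where "K = K1 + K2 + K3"
  define C where "C = C0 + C1 + C2 + C3"
  define A where "A = 2 + 2 * G / (1 - \<alpha>) * K"
  define B where "B = 2 * G * lam / (1 - \<alpha>)"
  \<comment> \<open>Equality in the largeness condition on \<open>\<beta>\<close>; neither \<open>\<beta>\<close> nor \<open>A\<close> depends on \<open>N\<close>, \<open>\<tau>\<close> or the data.\<close>
  define \<beta> where "\<beta> = (2 * B * C) powr (1 / \<alpha>)"
  have B: "0 < B" using G assms by (simp add: B_def)
  have C: "0 < C" using C0 C1 C2 C3 by (simp add: C_def)
  have K: "0 < K" using K1 K2 K3 by (simp add: K_def)
  have A: "0 < A" using G K assms by (simp add: A_def add_pos_pos)
  have \<beta>: "0 < \<beta>" "\<beta> powr \<alpha> = 2 * B * C"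
    using B C assms(1) by (simp_all add: \<beta>_def powr_powr)

  show ?thesis
  proof (intro exI[of _ "2 * A * exp (\<beta> * T)"] conjI allI impI ballI)
    show "0 < 2 * A * exp (\<beta> * T)" using A by simp
  next
    fix N :: nat and \<tau> \<mu>1 \<mu>2 \<eta> :: real and y :: "nat \<Rightarrow> real" and n
    assume N: "0 < N" and \<tau>_eq: "\<tau> = T / real N" and \<tau>_less: "\<tau> < tau_star \<alpha> lam"
      and \<mu>1: "0 \<le> \<mu>1" and \<mu>2: "0 \<le> \<mu>2" and \<eta>: "0 \<le> \<eta>"
      and y: "\<forall>i\<le>N. 0 \<le> y i"
      and ineq: "\<forall>n\<in>{1..N}. L1_op \<alpha> \<tau> y n
        \<le> lam * y n + \<mu>1 * real n powr (-\<sigma>1) + \<mu>2 * real n powr (-\<sigma>2) + \<eta>"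
      and n: "n \<in> {1..N}"
    have \<tau>: "0 < \<tau>" using N assms(6) by (simp add: \<tau>_eq)
    \<comment> \<open>All four summands are written as multiples of \<open>n powr - s\<close> with \<open>s < 1\<close>, the form to which the bounds \<open>C0\<close> to \<open>C3\<close> apply.\<close>
    define \<rho> where "\<rho> = (\<lambda>n. y 0 * real n powr - 0 + \<mu>1 * \<tau> powr \<alpha> * real n powr - (1 - \<alpha>)
      + \<mu>2 * \<tau> powr \<alpha> * real n powr - (\<sigma>2 - \<alpha>) + \<eta> * \<tau> powr \<alpha> * real n powr - (- \<alpha>))"
    have y0: "0 \<le> y 0" using y by simp
    define f where "f = (\<lambda>j. \<mu>1 * real j powr - \<sigma>1 + \<mu>2 * real j powr - \<sigma>2 + \<eta> * real j powr - 0)"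

    have forcing: "2 * y 0 + 2 * G / (1 - \<alpha>) * \<tau> powr \<alpha>
        * (\<Sum>j=1..m. real (Suc (m - j)) powr (\<alpha> - 1) * f j) \<le> A * \<rho> m" if m: "1 \<le> m" for m
    proof -
      have K_le: "K1 \<le> K" "K2 \<le> K" "K3 \<le> K" using K1(1) K2(1) K3(1) by (simp_all add: K_def)
      have "(\<Sum>j=1..m. real (Suc (m - j)) powr (\<alpha> - 1) * f j)
          = \<mu>1 * ?F \<sigma>1 m + \<mu>2 * ?F \<sigma>2 m + \<eta> * ?F 0 m"
        unfolding f_def sum_distrib_left sum.distrib[symmetric]
        by (intro sum.cong refl) (simp only: distrib_left mult_ac)
      also have "\<dots> \<le> \<mu>1 * (K * real m powr (\<alpha> - 1)) + \<mu>2 * (K * real m powr (\<alpha> - \<sigma>2))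
          + \<eta> * (K * real m powr (\<alpha> - 0))"
        using \<mu>1 \<mu>2 \<eta> K_le
        by (intro add_mono mult_left_mono order_trans[OF K1(2)] order_trans[OF K2(2)]
            order_trans[OF K3(2)] mult_right_mono) auto
      finally have "2 * G / (1 - \<alpha>) * \<tau> powr \<alpha> * (\<Sum>j=1..m. real (Suc (m - j)) powr (\<alpha> - 1) * f j)
          \<le> 2 * G / (1 - \<alpha>) * \<tau> powr \<alpha> * (\<mu>1 * (K * real m powr (\<alpha> - 1))
            + \<mu>2 * (K * real m powr (\<alpha> - \<sigma>2)) + \<eta> * (K * real m powr (\<alpha> - 0)))"
        using G assms by (intro mult_left_mono) auto
      also have "\<dots> = 2 * G / (1 - \<alpha>) * K * (\<rho> m - y 0)"
        using m by (simp add: \<rho>_def algebra_simps)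
      also have "\<dots> \<le> A * (\<rho> m - y 0)"
        using m \<mu>1 \<mu>2 \<eta> by (intro mult_right_mono) (simp_all add: A_def \<rho>_def)
      finally have "2 * G / (1 - \<alpha>) * \<tau> powr \<alpha> * (\<Sum>j=1..m. real (Suc (m - j)) powr (\<alpha> - 1) * f j)
          \<le> A * \<rho> m - A * y 0" by (simp only: right_diff_distrib)
      moreover have "2 * y 0 \<le> A * y 0"
        using y0 G K assms by (intro mult_right_mono) (simp_all add: A_def)
      ultimately show ?thesis by linarith
    qed

    have "y n \<le> 2 * A * \<rho> n * exp (\<beta> * \<tau> * real n)"
    proof (rule weakly_singular_gronwall)
      show "0 < \<beta>" "0 < \<tau>" "0 \<le> A" "0 \<le> B" "2 * B * C \<le> \<beta> powr \<alpha>" "1 \<le> n" "n \<le> N"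
        using \<beta> \<tau> A B n by simp_all
      show "0 \<le> \<rho> m" for m using y0 \<mu>1 \<mu>2 \<eta> by (simp add: \<rho>_def)
      show "(\<Sum>j=1..<m. (\<beta> * \<tau>) powr \<alpha> * real (m - j) powr (\<alpha> - 1)
          * exp (- (\<beta> * \<tau> * real (m - j))) * \<rho> j) \<le> C * \<rho> m" for m
      proof -
        have x: "0 < \<beta> * \<tau>" using \<beta> \<tau> by simp
        have C_le: "C0 \<le> C" "C1 \<le> C" "C2 \<le> C" "C3 \<le> C"
          using C0(1) C1(1) C2(1) C3(1) by (simp_all add: C_def)
        have "(\<Sum>j=1..<m. (\<beta> * \<tau>) powr \<alpha> * real (m - j) powr (\<alpha> - 1)
            * exp (- (\<beta> * \<tau> * real (m - j))) * \<rho> j)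
          = y 0 * ?W (\<beta> * \<tau>) 0 m + \<mu>1 * \<tau> powr \<alpha> * ?W (\<beta> * \<tau>) (1 - \<alpha>) m
            + \<mu>2 * \<tau> powr \<alpha> * ?W (\<beta> * \<tau>) (\<sigma>2 - \<alpha>) m + \<eta> * \<tau> powr \<alpha> * ?W (\<beta> * \<tau>) (- \<alpha>) m"
          unfolding \<rho>_def sum_distrib_left sum.distrib[symmetric]
          by (intro sum.cong refl) (simp only: distrib_left mult_ac)
        also have "\<dots> \<le> y 0 * (C * real m powr - 0) + \<mu>1 * \<tau> powr \<alpha> * (C * real m powr - (1 - \<alpha>))
            + \<mu>2 * \<tau> powr \<alpha> * (C * real m powr - (\<sigma>2 - \<alpha>)) + \<eta> * \<tau> powr \<alpha> * (C * real m powr - (- \<alpha>))"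
          using y0 \<mu>1 \<mu>2 \<eta> C_le
          by (intro add_mono mult_left_mono order_trans[OF C0(2)[OF x]] order_trans[OF C1(2)[OF x]]
              order_trans[OF C2(2)[OF x]] order_trans[OF C3(2)[OF x]] mult_right_mono) auto
        also have "\<dots> = C * \<rho> m"
          unfolding \<rho>_def by (simp only: distrib_left mult_ac)
        finally show ?thesis .
      qed
      show "y m \<le> A * \<rho> m + B * \<tau> powr \<alpha> * (\<Sum>j=1..<m. real (m - j) powr (\<alpha> - 1) * y j)"
        if m: "1 \<le> m" "m \<le> N" for m
      proof -
        have "y m \<le> 2 * y 0
          + 2 * Gamma (2 - \<alpha>) / (1 - \<alpha>) * \<tau> powr \<alpha> * (\<Sum>j=1..m. real (Suc (m - j)) powr (\<alpha> - 1) * f j)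
          + 2 * Gamma (2 - \<alpha>) * lam / (1 - \<alpha>) * \<tau> powr \<alpha> * (\<Sum>j=1..<m. real (m - j) powr (\<alpha> - 1) * y j)"
        proof (rule L1_inequality_integrated[OF assms(1-3) \<tau> \<tau>_less])
          show "0 \<le> y i" if "i \<le> m" for i using y that m by simp
          show "0 \<le> f j" for j using \<mu>1 \<mu>2 \<eta> by (simp add: f_def)
          show "L1_op \<alpha> \<tau> y j \<le> lam * y j + f j" if "1 \<le> j" "j \<le> m" for j
            using ineq[rule_format, of j] that m by (simp add: f_def add_ac)
        qed (use m in simp)
        then show ?thesis
          using forcing[OF m(1)] unfolding B_def G_def by linarith
      qed
    qed
    also have "\<dots> \<le> 2 * A * \<rho> n * exp (\<beta> * T)"
    proof (intro mult_left_mono)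
      have "\<tau> * real n \<le> T"
        using n N assms(6) by (simp add: \<tau>_eq field_simps)
      then show "exp (\<beta> * \<tau> * real n) \<le> exp (\<beta> * T)"
        using \<beta>(1) by (simp add: mult.assoc)
      show "0 \<le> 2 * A * \<rho> n" using A y0 \<mu>1 \<mu>2 \<eta> by (simp add: \<rho>_def)
    qed
    also have "\<dots> = 2 * A * exp (\<beta> * T) * \<rho> n" by (simp only: mult_ac)
    also have "\<rho> n = y 0 + \<mu>1 * \<tau> powr \<alpha> * real n powr (\<alpha> - 1)
               + \<mu>2 * \<tau> powr \<alpha> * real n powr (\<alpha> - \<sigma>2)
               + \<eta> * \<tau> powr \<alpha> * real n powr \<alpha>"
      using n by (simp add: \<rho>_def)
    finally show "y n \<le> 2 * A * exp (\<beta> * T) * (y 0 + \<mu>1 * \<tau> powr \<alpha> * real n powr (\<alpha> - 1)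
               + \<mu>2 * \<tau> powr \<alpha> * real n powr (\<alpha> - \<sigma>2)
               + \<eta> * \<tau> powr \<alpha> * real n powr \<alpha>)" .
  qed
qed

end
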